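(* $k(4)=24$, where $k(n)$ denotes the kissing number in $\mathbf{R}^n$.
   Context: The kissing number $k(n)$ is the highest number of equal-size nonoverlapping spheres in $\mathbf{R}^n$ that can touch another sphere of the same size. Equivalently, $k(n)$ is the maximal cardinality of a finite set $X$ of points on the unit sphere $\mathbf{S}^{n-1}\subset\mathbf{R}^n$ such that the angular distance between any two distinct points of $X$ is at least $\pi/3$ (i.e. $x\cdot y\le 1/2$ for all distinct $x,y\in X$). *)

theory Defs
  imports "HOL-Analysis.Analysis"
begin

(* C is the set of centres of spheres of radius r that touch the sphere of radius r
   centred at p. Nonoverlapping means that the bounded open balls are disjoint; this is
   also required with respect to the central ball, so that tangency is external. *)
definition kissing_configuration :: "'a::euclidean_space \<Rightarrow> real \<Rightarrow> 'a set \<Rightarrow> bool" where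
  "kissing_configuration p r C \<longleftrightarrow>
     0 < r \<and> finite C \<and>
     (\<forall>c\<in>C. sphere c r \<inter> sphere p r \<noteq> {} \<and> disjnt (ball c r) (ball p r)) \<and>
     pairwise (\<lambda>c d. disjnt (ball c r) (ball d r)) C"

(* The dimension n is CARD('n), so that k(n) is written kissing_number TYPE('n). The maximum
   exists: see finite_kissing_cards and kissing_cards_nonempty. *)
definition kissing_number :: "'n::finite itself \<Rightarrow> nat" where
  "kissing_number _ = Max {card C | (p :: real ^ 'n) r C. kissing_configuration p r C}"

lemma disjnt_ball_iff:
  fixes c d :: "'a::euclidean_space"
  assumes "0 < r"
  shows "disjnt (ball c r) (ball d r) \<longleftrightarrow> 2 * r \<le> dist c d"
proof
  assume dj: "disjnt (ball c r) (ball d r)"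
  show "2 * r \<le> dist c d"
  proof (rule ccontr)
    assume "\<not> 2 * r \<le> dist c d"
    then have "midpoint c d \<in> ball c r" "midpoint c d \<in> ball d r"
      by (auto simp: dist_midpoint)
    with dj show False by (auto simp: disjnt_iff)
  qed
next
  assume le: "2 * r \<le> dist c d"
  have False if "x \<in> ball c r" "x \<in> ball d r" for x
    using that le dist_triangle2[of c d x] by (auto simp: dist_commute)
  then show "disjnt (ball c r) (ball d r)" by (auto simp: disjnt_iff)
qed

lemma touching_iff:
  fixes c p :: "'a::euclidean_space"
  assumes "0 < r"
  shows "sphere c r \<inter> sphere p r \<noteq> {} \<and> disjnt (ball c r) (ball p r) \<longleftrightarrow> dist c p = 2 * r"
proof
  assume a: "sphere c r \<inter> sphere p r \<noteq> {} \<and> disjnt (ball c r) (ball p r)"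
  then obtain x where "x \<in> sphere c r" "x \<in> sphere p r" by blast
  then have "dist c x = r" "dist p x = r" by simp_all
  then have "dist c p \<le> 2 * r" using dist_triangle2[of c p x] by linarith
  with a show "dist c p = 2 * r" using disjnt_ball_iff[OF assms] by force
next
  assume d: "dist c p = 2 * r"
  then have "midpoint c p \<in> sphere c r \<inter> sphere p r" by (auto simp: dist_midpoint)
  then show "sphere c r \<inter> sphere p r \<noteq> {} \<and> disjnt (ball c r) (ball p r)"
    using d disjnt_ball_iff[OF assms, of c p] by (metis empty_iff order_refl)
qed

lemma kissing_configuration_iff_dist:
  fixes p :: "'a::euclidean_space"
  shows "kissing_configuration p r C \<longleftrightarrow>
    0 < r \<and> finite C \<and> (\<forall>c\<in>C. dist c p = 2 * r) \<and> pairwise (\<lambda>c d. 2 * r \<le> dist c d) C"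
proof (cases "0 < r")
  case True
  show ?thesis
    by (simp only: kissing_configuration_def touching_iff[OF True])
      (simp only: disjnt_ball_iff[OF True])
qed (simp add: kissing_configuration_def)

lemma unit_inner_le_half_iff:
  fixes x y :: "'a::real_inner"
  assumes "norm x = 1" "norm y = 1"
  shows "x \<bullet> y \<le> 1/2 \<longleftrightarrow> 1 \<le> dist x y"
proof -
  have "x \<bullet> x = 1" "y \<bullet> y = 1" using assms by (auto simp: norm_eq_1)
  then have "(dist x y)\<^sup>2 = 2 - 2 * (x \<bullet> y)"
    unfolding dist_norm power2_norm_eq_inner inner_diff_left inner_diff_right
    using inner_commute[of y x] by linarith
  moreover have "1 \<le> dist x y \<longleftrightarrow> 1 \<le> (dist x y)\<^sup>2"
    using abs_le_square_iff[of 1 "dist x y"] by simp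
  ultimately show ?thesis by auto
qed

lemma kissing_cards_eq_spherical_codes:
  "{card C | (p :: 'a::euclidean_space) r C. kissing_configuration p r C} =
   {card X | X :: 'a set. finite X \<and> X \<subseteq> sphere 0 1 \<and> pairwise (\<lambda>x y. x \<bullet> y \<le> 1/2) X}"
    (is "?L = ?R")
proof (intro equalityI subsetI)
  fix k assume "k \<in> ?L"
  then obtain p :: 'a and r C where k: "k = card C" and "kissing_configuration p r C" by auto
  then have r: "0 < r" and C: "finite C" and n: "\<And>c. c \<in> C \<Longrightarrow> dist c p = 2 * r"
    and sep: "\<And>c d. c \<in> C \<Longrightarrow> d \<in> C \<Longrightarrow> c \<noteq> d \<Longrightarrow> 2 * r \<le> dist c d"
    by (auto simp: kissing_configuration_iff_dist pairwise_def)
  define f where "f c = (c - p) /\<^sub>R (2 * r)" for c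
  have inj: "inj_on f C" using r by (auto simp: inj_on_def f_def)
  have df: "dist (f c) (f d) = dist c d / (2 * r)" for c d
  proof -
    have "f c - f d = (c - d) /\<^sub>R (2 * r)"
      unfolding f_def scaleR_diff_right[symmetric] by simp
    then have "dist (f c) (f d) = \<bar>inverse (2 * r)\<bar> * dist c d"
      unfolding dist_norm by (simp only: norm_scaleR)
    also have "\<dots> = dist c d / (2 * r)"
      using r by (simp add: divide_simps)
    finally show ?thesis .
  qed
  have nf: "norm (f c) = 1" if "c \<in> C" for c
    using n[OF that] r unfolding f_def dist_norm norm_scaleR by (simp only:) simp
  have "f c \<bullet> f d \<le> 1/2" if "c \<in> C" "d \<in> C" "f c \<noteq> f d" for c d
  proof -
    have "2 * r \<le> dist c d" using that sep by blast
    then have "1 \<le> dist (f c) (f d)" using r by (simp add: df)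
    then show ?thesis using unit_inner_le_half_iff[OF nf[OF that(1)] nf[OF that(2)]] by blast
  qed
  then have "finite (f ` C) \<and> f ` C \<subseteq> sphere 0 1 \<and> pairwise (\<lambda>x y. x \<bullet> y \<le> 1/2) (f ` C)"
    using C nf by (auto simp: pairwise_def)
  moreover have "k = card (f ` C)" using k card_image[OF inj] by simp
  ultimately show "k \<in> ?R" by blast
next
  fix k assume "k \<in> ?R"
  then obtain X :: "'a set" where X: "k = card X" "finite X" "X \<subseteq> sphere 0 1"
    "pairwise (\<lambda>x y. x \<bullet> y \<le> 1/2) X" by auto
  have n: "norm x = 1" if "x \<in> X" for x using X(3) that by auto
  have "1 \<le> dist x y" if "x \<in> X" "y \<in> X" "x \<noteq> y" for x y
    using X(4) that unit_inner_le_half_iff[OF n[OF that(1)] n[OF that(2)]]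
    unfolding pairwise_def by blast
  then have "kissing_configuration 0 (1/2) X"
    unfolding kissing_configuration_iff_dist pairwise_def using X(2) n by simp
  then show "k \<in> ?L" using X(1) by blast
qed

lemma finite_kissing_cards:
  "finite {card C | (p :: 'a::euclidean_space) r C. kissing_configuration p r C}"
proof -
  have "sphere (0::'a) 1 \<subseteq> (\<Union>c\<in>sphere 0 1. ball c (1/2))" by auto
  then obtain K where K: "finite K" "sphere (0::'a) 1 \<subseteq> (\<Union>c\<in>K. ball c (1/2))"
    using compactE_image[of "sphere (0::'a) 1" "sphere 0 1" "\<lambda>c. ball c (1/2)"]
    by (metis compact_sphere open_ball)
  have "card X \<le> card K"
    if X: "finite X" "X \<subseteq> sphere 0 1" "pairwise (\<lambda>x y. x \<bullet> y \<le> 1/2) X" for X :: "'a set"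
  proof -
    have "\<forall>x\<in>X. \<exists>c\<in>K. x \<in> ball c (1/2)" using X(2) K(2) by blast
    then obtain g where g: "\<And>x. x \<in> X \<Longrightarrow> g x \<in> K" "\<And>x. x \<in> X \<Longrightarrow> dist (g x) x < 1/2"
      by (metis mem_ball)
    have "inj_on g X"
    proof (rule inj_onI, rule ccontr)
      fix x y assume xy: "x \<in> X" "y \<in> X" "g x = g y" "x \<noteq> y"
      then have "dist x y < 1"
        using g(2)[of x] g(2)[of y] dist_triangle3[of x y "g x"] by simp
      moreover have "1 \<le> dist x y"
        using xy X(2,3) by (subst unit_inner_le_half_iff[symmetric]) (auto simp: pairwise_def)
      ultimately show False by simp
    qed
    then show ?thesis using g(1) K(1) by (metis card_inj_on_le image_subsetI)
  qed
  then have "{card C | (p :: 'a) r C. kissing_configuration p r C} \<subseteq> {..card K}"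
    unfolding kissing_cards_eq_spherical_codes by auto
  then show ?thesis by (rule finite_subset) simp
qed

lemma kissing_cards_nonempty:
  "{card C | (p :: 'a::euclidean_space) r C. kissing_configuration p r C} \<noteq> {}"
proof -
  have "kissing_configuration (0::'a) 1 {}" by (simp add: kissing_configuration_def)
  then show ?thesis by blast
qed

end

theory Submission
  imports Defs
begin

text \<open>The upper bound is a three-point semidefinite programming bound in the style of Bachoc and
  Vallentin. Let \<open>X\<close> be a set of 25 unit vectors with inner products at most \<open>1/2\<close>, and for
  \<open>x, y, z \<in> X\<close> write \<open>u = x \<bullet> y\<close>, \<open>v = x \<bullet> z\<close>, \<open>t = y \<bullet> z\<close>. Projecting to the orthogonal complement of \<open>x\<close>, the
  homogenised Legendre polynomials \<open>Q\<^sub>k(u, v, t)\<close> become positive semidefinite kernels in \<open>y, z\<close>, so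
  \<open>K = \<Sum> g(u) g(v) Q\<^sub>k(u, v, t)\<close> has a nonnegative sum over all triples from \<open>X\<close>.
  Split this sum according to coincidences among \<open>x, y, z\<close>. Since \<open>X\<close> has exactly 25 points, the sum of
  a univariate \<open>c(u)\<close> over triples of distinct points is 23 times its sum over pairs, so such a \<open>c\<close> can be
  moved freely between the two parts. The polynomials \<open>g\<close> and \<open>c\<close> are chosen such that,
  up to symmetrisation and a tiny remainder,
  \<open>-(K + c) = (1 - 2u) \<sigma> + (1 + 2uvt - u\<^sup>2 - v\<^sup>2 - t\<^sup>2) \<tau>\<close> with sums of squares \<open>\<sigma>, \<tau>\<close>,
  and the pair contribution is bounded by a negative constant on \<open>[-1, 1/2]\<close>, again by sums of squares.
  The total is then negative, a contradiction. The remainders need not vanish: all variables lie in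
  \<open>[-1, 1]\<close>, so the sum of the absolute values of the coefficients bounds them.\<close>

section \<open>Dense integer polynomials in three variables\<close>

text \<open>A polynomial is the list of its coefficients in increasing degree; for \<open>poly3\<close> the outermost
  list belongs to the first variable. The operations take the operations on coefficients as
  arguments, so that the three levels share one definition and one correctness proof.\<close>

type_synonym poly2 = "int list list"
type_synonym poly3 = "int list list list"

fun lev :: "('a \<Rightarrow> real) \<Rightarrow> real \<Rightarrow> 'a list \<Rightarrow> real" where
  "lev e x [] = 0"
| "lev e x (a # p) = e a + x * lev e x p"

fun ladd :: "('a \<Rightarrow> 'a \<Rightarrow> 'a) \<Rightarrow> 'a list \<Rightarrow> 'a list \<Rightarrow> 'a list" where
  "ladd f [] q = q"
| "ladd f p [] = p"
| "ladd f (a # p) (b # q) = f a b # ladd f p q"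

fun lmul :: "('a \<Rightarrow> 'a \<Rightarrow> 'a) \<Rightarrow> 'a \<Rightarrow> ('a \<Rightarrow> 'a \<Rightarrow> 'a) \<Rightarrow> 'a list \<Rightarrow> 'a list \<Rightarrow> 'a list" where
  "lmul f z m [] q = []"
| "lmul f z m (a # p) q = ladd f (map (m a) q) (z # lmul f z m p q)"

text \<open>Squaring by \<open>(a + x p)\<^sup>2 = a\<^sup>2 + x (2 a p + x p\<^sup>2)\<close> needs half the products of \<open>lmul\<close>; the arguments
  \<open>s\<close> and \<open>d\<close> are squaring and doubling of coefficients.\<close>

fun lsq :: "('a \<Rightarrow> 'a \<Rightarrow> 'a) \<Rightarrow> 'a \<Rightarrow> ('a \<Rightarrow> 'a \<Rightarrow> 'a) \<Rightarrow> ('a \<Rightarrow> 'a) \<Rightarrow> ('a \<Rightarrow> 'a) \<Rightarrow> 'a list \<Rightarrow> 'a list" where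
  "lsq f z m s d [] = []"
| "lsq f z m s d (a # p) = s a # ladd f (map (m (d a)) p) (z # lsq f z m s d p)"

lemma lev_ladd:
  assumes "\<And>a b. e (f a b) = e a + e b"
  shows "lev e x (ladd f p q) = lev e x p + lev e x q"
  using assms by (induction f p q rule: ladd.induct) (auto simp: algebra_simps)

lemma lev_map:
  assumes "\<And>a. e (g a) = c * e a"
  shows "lev e x (map g p) = c * lev e x p"
  by (induction p) (auto simp: assms algebra_simps)

lemma lev_lmul:
  assumes "\<And>a b. e (f a b) = e a + e b" "e z = 0" "\<And>a b. e (m a b) = e a * e b"
  shows "lev e x (lmul f z m p q) = lev e x p * lev e x q"
  by (induction p) (auto simp: lev_ladd assms lev_map[of e "m a" "e a" for a] algebra_simps)

lemma lev_lsq: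
  assumes "\<And>a b. e (f a b) = e a + e b" "e z = 0" "\<And>a b. e (m a b) = e a * e b"
    "\<And>a. e (s a) = (e a)\<^sup>2" "\<And>a. e (d a) = 2 * e a"
  shows "lev e x (lsq f z m s d p) = (lev e x p)\<^sup>2"
  by (induction p)
    (auto simp: lev_ladd assms lev_map[of e "m (d a)" "2 * e a" for a] algebra_simps power2_eq_square)

text \<open>In Horner evaluation, a multiplication by \<open>x\<close> with |x| at most 1 never
  increases the absolute value.\<close>

lemma abs_lev_le:
  assumes "\<And>a. \<bar>e a\<bar> \<le> of_int (n a)" "\<bar>x\<bar> \<le> 1"
  shows "\<bar>lev e x p\<bar> \<le> of_int (sum_list (map n p))"
proof (induction p)
  case (Cons a p)
  have "\<bar>x * lev e x p\<bar> \<le> \<bar>lev e x p\<bar>"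
    using assms(2) by (simp add: abs_mult mult_left_le_one_le)
  then show ?case using Cons assms(1)[of a] by simp
qed simp

definition "add1 = ladd ((+) :: int \<Rightarrow> int \<Rightarrow> int)"
definition "add2 = ladd add1"
definition "add3 = ladd add2"
definition "mul1 = lmul (+) (0 :: int) (*)"
definition "mul2 = lmul add1 [] mul1"
definition "mul3 = lmul add2 [] mul2"
definition "sq1 = lsq (+) (0 :: int) (*) (\<lambda>a. a * a) (\<lambda>a. 2 * a)"
definition "sq2 = lsq add1 [] mul1 sq1 (map (\<lambda>a. 2 * a))"
definition "sq3 = lsq add2 [] mul2 sq2 (map (map (\<lambda>a. 2 * a)))"

definition ev1 :: "real \<Rightarrow> int list \<Rightarrow> real" where "ev1 = lev of_int"
definition ev2 :: "real \<Rightarrow> real \<Rightarrow> poly2 \<Rightarrow> real" where "ev2 v t = lev (ev1 t) v"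
definition ev3 :: "real \<Rightarrow> real \<Rightarrow> real \<Rightarrow> poly3 \<Rightarrow> real" where "ev3 u v t = lev (ev2 v t) u"

definition norm3 :: "poly3 \<Rightarrow> int" where
  "norm3 p = sum_list (map (\<lambda>q. sum_list (map (\<lambda>r. sum_list (map abs r)) q)) p)"

lemma ev_Nil [simp]: "ev1 u [] = 0" "ev2 u v [] = 0" "ev3 u v t [] = 0"
  by (simp_all add: ev1_def ev2_def ev3_def)

lemma ev_Cons [simp]:
  "ev1 u (a # p) = of_int a + u * ev1 u p"
  "ev2 u v (b # q) = ev1 v b + u * ev2 u v q"
  "ev3 u v t (c # r) = ev2 v t c + u * ev3 u v t r"
  by (simp_all add: ev1_def ev2_def ev3_def)

lemma ev_add [simp]:
  "ev1 u (add1 p q) = ev1 u p + ev1 u q"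
  "ev2 u v (add2 p' q') = ev2 u v p' + ev2 u v q'"
  "ev3 u v t (add3 p'' q'') = ev3 u v t p'' + ev3 u v t q''"
proof -
  show 1: "ev1 u (add1 p q) = ev1 u p + ev1 u q" for u p q
    unfolding ev1_def add1_def by (rule lev_ladd) simp
  show 2: "ev2 u v (add2 p q) = ev2 u v p + ev2 u v q" for u v p q
    unfolding ev2_def add2_def by (rule lev_ladd) (rule 1)
  show "ev3 u v t (add3 p'' q'') = ev3 u v t p'' + ev3 u v t q''"
    unfolding ev3_def add3_def by (rule lev_ladd) (rule 2)
qed

lemma ev_mul [simp]:
  "ev1 u (mul1 p q) = ev1 u p * ev1 u q"
  "ev2 u v (mul2 p' q') = ev2 u v p' * ev2 u v q'"
  "ev3 u v t (mul3 p'' q'') = ev3 u v t p'' * ev3 u v t q''"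
proof -
  show 1: "ev1 u (mul1 p q) = ev1 u p * ev1 u q" for u p q
    unfolding ev1_def mul1_def by (rule lev_lmul) simp_all
  show 2: "ev2 u v (mul2 p q) = ev2 u v p * ev2 u v q" for u v p q
    unfolding ev2_def mul2_def by (rule lev_lmul) (simp_all add: 1)
  show "ev3 u v t (mul3 p'' q'') = ev3 u v t p'' * ev3 u v t q''"
    unfolding ev3_def mul3_def by (rule lev_lmul) (simp_all add: 2)
qed

lemma ev_double:
  "ev1 u (map (\<lambda>a. 2 * a) p) = 2 * ev1 u p"
  "ev2 u v (map (map (\<lambda>a. 2 * a)) q) = 2 * ev2 u v q"
proof -
  show 1: "ev1 u (map (\<lambda>a. 2 * a) p) = 2 * ev1 u p" for u p
    unfolding ev1_def by (rule lev_map) simp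
  show "ev2 u v (map (map (\<lambda>a. 2 * a)) q) = 2 * ev2 u v q"
    unfolding ev2_def by (rule lev_map) (rule 1)
qed

lemma ev_sq [simp]:
  "ev1 u (sq1 p) = (ev1 u p)\<^sup>2"
  "ev2 u v (sq2 p') = (ev2 u v p')\<^sup>2"
  "ev3 u v t (sq3 p'') = (ev3 u v t p'')\<^sup>2"
proof -
  show 1: "ev1 u (sq1 p) = (ev1 u p)\<^sup>2" for u p
    unfolding ev1_def sq1_def by (rule lev_lsq) (simp_all add: power2_eq_square)
  show 2: "ev2 u v (sq2 p) = (ev2 u v p)\<^sup>2" for u v p
    unfolding ev2_def sq2_def by (rule lev_lsq) (simp_all add: 1 ev_double)
  show "ev3 u v t (sq3 p'') = (ev3 u v t p'')\<^sup>2"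
    unfolding ev3_def sq3_def by (rule lev_lsq) (simp_all add: 2 ev_double)
qed

lemma abs_ev3_le:
  assumes "\<bar>u\<bar> \<le> 1" "\<bar>v\<bar> \<le> 1" "\<bar>t\<bar> \<le> 1"
  shows "\<bar>ev3 u v t p\<bar> \<le> of_int (norm3 p)"
  unfolding ev3_def norm3_def ev2_def ev1_def
  by (intro abs_lev_le assms) simp

definition sum1 :: "int list list \<Rightarrow> int list" where "sum1 ps = foldr add1 ps []"
definition sum3 :: "poly3 list \<Rightarrow> poly3" where "sum3 ps = foldr add3 ps []"

lemma ev_sum [simp]:
  "ev1 u (sum1 ps) = (\<Sum>p\<leftarrow>ps. ev1 u p)" "ev3 u v t (sum3 qs) = (\<Sum>q\<leftarrow>qs. ev3 u v t q)"
proof -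
  show "ev1 u (sum1 ps) = (\<Sum>p\<leftarrow>ps. ev1 u p)" by (induction ps) (auto simp: sum1_def)
  show "ev3 u v t (sum3 qs) = (\<Sum>q\<leftarrow>qs. ev3 u v t q)" by (induction qs) (auto simp: sum3_def)
qed

definition in_first :: "int list \<Rightarrow> poly3" where "in_first p = map (\<lambda>a. [[a]]) p"
definition in_second :: "int list \<Rightarrow> poly3" where "in_second p = [map (\<lambda>a. [a]) p]"

lemma ev_in [simp]: "ev3 u v t (in_first p) = ev1 u p" "ev3 u v t (in_second p) = ev1 v p"
proof -
  show "ev3 u v t (in_first p) = ev1 u p" by (induction p) (auto simp: in_first_def)
  have "ev2 v t (map (\<lambda>a. [a]) p) = ev1 v p" by (induction p) auto
  then show "ev3 u v t (in_second p) = ev1 v p" by (simp add: in_second_def)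
qed

definition monom3 :: "int \<Rightarrow> nat \<Rightarrow> nat \<Rightarrow> nat \<Rightarrow> poly3" where
  "monom3 a i j k = replicate i [] @ [replicate j [] @ [replicate k 0 @ [a]]]"

lemma ev_monom3 [simp]: "ev3 u v t (monom3 a i j k) = of_int a * u ^ i * v ^ j * t ^ k"
proof -
  have 1: "ev1 t (replicate k 0 @ [a]) = of_int a * t ^ k" by (induction k) auto
  have 2: "ev2 v t (replicate j [] @ [r]) = v ^ j * ev1 t r" for r by (induction j) auto
  have "ev3 u v t (replicate i [] @ [q]) = u ^ i * ev2 v t q" for q by (induction i) auto
  then show ?thesis by (simp add: monom3_def 1 2 mult_ac)
qed

text \<open>\<open>fold3\<close> replaces every exponent triple by its decreasing rearrangement; this preserves the sum of
  the polynomial over the permutations of its variables.\<close>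

definition sorted_monom3 :: "int \<Rightarrow> nat \<Rightarrow> nat \<Rightarrow> nat \<Rightarrow> poly3" where
  "sorted_monom3 a i j k =
     monom3 a (max i (max j k)) (max (min i j) (min (max i j) k)) (min i (min j k))"

fun fold1 :: "nat \<Rightarrow> nat \<Rightarrow> nat \<Rightarrow> int list \<Rightarrow> poly3" where
  "fold1 i j k [] = []"
| "fold1 i j k (a # p) = add3 (sorted_monom3 a i j k) (fold1 i j (Suc k) p)"

fun fold2 :: "nat \<Rightarrow> nat \<Rightarrow> poly2 \<Rightarrow> poly3" where
  "fold2 i j [] = []"
| "fold2 i j (p # q) = add3 (fold1 i j 0 p) (fold2 i (Suc j) q)"

fun fold3 :: "nat \<Rightarrow> poly3 \<Rightarrow> poly3" where
  "fold3 i [] = []"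
| "fold3 i (q # r) = add3 (fold2 i 0 q) (fold3 (Suc i) r)"

section \<open>Sums over pairs and triples of distinct points\<close>

definition psum :: "'a set \<Rightarrow> ('a \<Rightarrow> 'a \<Rightarrow> real) \<Rightarrow> real" where
  "psum X f = (\<Sum>x\<in>X. \<Sum>y\<in>X. if x \<noteq> y then f x y else 0)"

definition tsum :: "'a set \<Rightarrow> ('a \<Rightarrow> 'a \<Rightarrow> 'a \<Rightarrow> real) \<Rightarrow> real" where
  "tsum X f = (\<Sum>x\<in>X. \<Sum>y\<in>X. \<Sum>z\<in>X. if x \<noteq> y \<and> x \<noteq> z \<and> y \<noteq> z then f x y z else 0)"

lemma psum_mono:
  assumes "\<And>x y. x \<in> X \<Longrightarrow> y \<in> X \<Longrightarrow> x \<noteq> y \<Longrightarrow> f x y \<le> g x y"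
  shows "psum X f \<le> psum X g"
  unfolding psum_def using assms by (intro sum_mono) auto

lemma tsum_mono:
  assumes "\<And>x y z. x \<in> X \<Longrightarrow> y \<in> X \<Longrightarrow> z \<in> X \<Longrightarrow> x \<noteq> y \<Longrightarrow> x \<noteq> z \<Longrightarrow> y \<noteq> z \<Longrightarrow> f x y z \<le> g x y z"
  shows "tsum X f \<le> tsum X g"
  unfolding tsum_def using assms by (intro sum_mono) auto

lemma psum_add: "psum X (\<lambda>x y. f x y + g x y) = psum X f + psum X g"
  unfolding psum_def sum.distrib[symmetric] by (intro sum.cong) auto

lemma psum_cmul: "psum X (\<lambda>x y. c * f x y) = c * psum X f"
  unfolding psum_def sum_distrib_left by (intro sum.cong) auto

lemma tsum_add: "tsum X (\<lambda>x y z. f x y z + g x y z) = tsum X f + tsum X g"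
  unfolding tsum_def sum.distrib[symmetric] by (intro sum.cong) auto

lemma tsum_cmul: "tsum X (\<lambda>x y z. c * f x y z) = c * tsum X f"
  unfolding tsum_def sum_distrib_left by (intro sum.cong) auto

lemma tsum_swap12: "tsum X (\<lambda>x y z. f x y z) = tsum X (\<lambda>x y z. f y x z)"
  unfolding tsum_def by (subst sum.swap) (intro sum.cong refl, auto)

lemma tsum_swap23: "tsum X (\<lambda>x y z. f x y z) = tsum X (\<lambda>x y z. f x z y)"
  unfolding tsum_def by (rule sum.cong[OF refl], subst sum.swap) (intro sum.cong refl, auto)

lemma psum_const:
  assumes "finite X"
  shows "psum X (\<lambda>x y. c) = real (card X) * (real (card X) - 1) * c"
proof -
  have "(\<Sum>y\<in>X. if x \<noteq> y then c else 0) = (real (card X) - 1) * c" if "x \<in> X" for x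
  proof -
    have "(\<Sum>y\<in>X. if x \<noteq> y then c else 0) = (\<Sum>y\<in>X. c - (if x = y then c else 0))"
      by (intro sum.cong) auto
    also have "\<dots> = (real (card X) - 1) * c"
      unfolding sum_subtractf using assms that by (simp add: algebra_simps)
    finally show ?thesis .
  qed
  then show ?thesis by (simp add: psum_def)
qed

text \<open>An ordered pair of distinct points extends to a triple of distinct points in
  \<open>card X - 2\<close> ways; this is the factor 23 for 25 points.\<close>

lemma tsum_pair:
  assumes "finite X"
  shows "tsum X (\<lambda>x y z. f x y) = (real (card X) - 2) * psum X f"
proof -
  have "(\<Sum>z\<in>X. if x \<noteq> y \<and> x \<noteq> z \<and> y \<noteq> z then f x y else 0)
      = (real (card X) - 2) * (if x \<noteq> y then f x y else 0)" if "x \<in> X" "y \<in> X" for x y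
  proof (cases "x = y")
    case False
    then have "(\<Sum>z\<in>X. if x \<noteq> y \<and> x \<noteq> z \<and> y \<noteq> z then f x y else 0)
        = (\<Sum>z\<in>X. f x y - (if x = z then f x y else 0) - (if y = z then f x y else 0))"
      by (intro sum.cong) auto
    also have "\<dots> = (real (card X) - 2) * f x y"
      unfolding sum_subtractf using assms that by (simp add: algebra_simps)
    finally show ?thesis using False by simp
  qed simp
  then show ?thesis unfolding tsum_def psum_def sum_distrib_left by (intro sum.cong refl) auto
qed

lemma sum_triples_split:
  assumes "finite X"
  shows "(\<Sum>x\<in>X. \<Sum>y\<in>X. \<Sum>z\<in>X. f x y z) =
    (\<Sum>x\<in>X. f x x x) + psum X (\<lambda>x y. f x x y + f x y x + f x y y) + tsum X f"
proof -
  let ?T = "\<lambda>x y z. if x \<noteq> y \<and> x \<noteq> z \<and> y \<noteq> z then f x y z else 0"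
  \<comment> \<open>One summand for each of the five coincidence patterns. The outermost condition
    fixes a summation variable, so that \<open>sum.delta\<close> can collapse its sum.\<close>
  have "f x y z = ?T x y z
      + (if z = x then (if y = x then f x x x else 0) else 0)
      + (if y = x then (if x \<noteq> z then f x x z else 0) else 0)
      + (if z = x then (if x \<noteq> y then f x y x else 0) else 0)
      + (if z = y then (if x \<noteq> y then f x y y else 0) else 0)" for x y z
    by auto
  then have "(\<Sum>x\<in>X. \<Sum>y\<in>X. \<Sum>z\<in>X. f x y z) = (\<Sum>x\<in>X. \<Sum>y\<in>X. \<Sum>z\<in>X. ?T x y z
      + (if z = x then (if y = x then f x x x else 0) else 0)
      + (if y = x then (if x \<noteq> z then f x x z else 0) else 0)
      + (if z = x then (if x \<noteq> y then f x y x else 0) else 0)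
      + (if z = y then (if x \<noteq> y then f x y y else 0) else 0))"
    by presburger
  also have "\<dots> = tsum X f
      + (\<Sum>x\<in>X. \<Sum>y\<in>X. \<Sum>z\<in>X. if z = x then (if y = x then f x x x else 0) else 0)
      + (\<Sum>x\<in>X. \<Sum>y\<in>X. \<Sum>z\<in>X. if y = x then (if x \<noteq> z then f x x z else 0) else 0)
      + (\<Sum>x\<in>X. \<Sum>y\<in>X. \<Sum>z\<in>X. if z = x then (if x \<noteq> y then f x y x else 0) else 0)
      + (\<Sum>x\<in>X. \<Sum>y\<in>X. \<Sum>z\<in>X. if z = y then (if x \<noteq> y then f x y y else 0) else 0)"
    unfolding tsum_def sum.distrib ..
  also have "(\<Sum>x\<in>X. \<Sum>y\<in>X. \<Sum>z\<in>X. if z = x then (if y = x then f x x x else 0) else 0)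
      = (\<Sum>x\<in>X. f x x x)"
    using assms by (intro sum.cong refl) (simp add: sum.delta)
  also have "(\<Sum>x\<in>X. \<Sum>y\<in>X. \<Sum>z\<in>X. if y = x then (if x \<noteq> z then f x x z else 0) else 0)
      = psum X (\<lambda>x y. f x x y)"
    unfolding psum_def using assms by - (rule sum.cong[OF refl], subst sum.swap, simp add: sum.delta)
  also have "(\<Sum>x\<in>X. \<Sum>y\<in>X. \<Sum>z\<in>X. if z = x then (if x \<noteq> y then f x y x else 0) else 0)
      = psum X (\<lambda>x y. f x y x)"
    unfolding psum_def using assms by (intro sum.cong refl) (simp add: sum.delta)
  also have "(\<Sum>x\<in>X. \<Sum>y\<in>X. \<Sum>z\<in>X. if z = y then (if x \<noteq> y then f x y y else 0) else 0)
      = psum X (\<lambda>x y. f x y y)"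
    unfolding psum_def using assms by (intro sum.cong refl) (simp add: sum.delta)
  finally show ?thesis by (simp add: psum_add)
qed

section \<open>Permutation symmetry of sums over triples\<close>

definition inner_tsum :: "'a::real_inner set \<Rightarrow> (real \<Rightarrow> real \<Rightarrow> real \<Rightarrow> real) \<Rightarrow> real" where
  "inner_tsum X F = tsum X (\<lambda>x y z. F (x \<bullet> y) (x \<bullet> z) (y \<bullet> z))"

text \<open>Exchanging the points \<open>x\<close> and \<open>y\<close> fixes \<open>u\<close> and
  exchanges \<open>v\<close> with \<open>t\<close>.\<close>

lemma inner_tsum_swap12: "inner_tsum X (\<lambda>u v t. F u v t) = inner_tsum X (\<lambda>u v t. F u t v)"
  unfolding inner_tsum_def by (subst tsum_swap12) (simp add: inner_commute)

lemma inner_tsum_swap23: "inner_tsum X (\<lambda>u v t. F u v t) = inner_tsum X (\<lambda>u v t. F v u t)"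
  unfolding inner_tsum_def by (subst tsum_swap23) (simp add: inner_commute)

lemma inner_tsum_add:
  "inner_tsum X (\<lambda>u v t. F u v t + G u v t) = inner_tsum X F + inner_tsum X G"
  unfolding inner_tsum_def by (rule tsum_add)

lemma inner_tsum_cmul: "inner_tsum X (\<lambda>u v t. c * F u v t) = c * inner_tsum X F"
  unfolding inner_tsum_def by (rule tsum_cmul)

lemma inner_tsum_zero: "inner_tsum X (\<lambda>u v t. 0) = 0"
  using inner_tsum_cmul[of X 0] by simp

text \<open>The two swaps generate all permutations of the exponents, and the sorted triple is one
  of these six.\<close>

lemma inner_tsum_sorted_monom3:
  "inner_tsum X (\<lambda>u v t. ev3 u v t (sorted_monom3 a i j k)) =
   inner_tsum X (\<lambda>u v t. of_int a * u ^ i * v ^ j * t ^ k)"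
proof -
  let ?M = "\<lambda>i j k. inner_tsum X (\<lambda>u v t. of_int a * u ^ i * v ^ j * t ^ k)"
  have a: "?M i j k = ?M i k j" for i j k
    by (subst inner_tsum_swap12) (simp add: mult_ac)
  have b: "?M i j k = ?M j i k" for i j k
    by (subst inner_tsum_swap23) (simp add: mult_ac)
  have perms: "?M i k j = ?M i j k" "?M j i k = ?M i j k" "?M j k i = ?M i j k" "?M k i j = ?M i j k"
      "?M k j i = ?M i j k"
    using a[of i j k] b[of i j k] b[of i k j] a[of j i k] a[of k i j] by (simp_all only:)
  have "?M i' j' k' = ?M i j k"
    if "(i', j', k') \<in> {(i, j, k), (i, k, j), (j, i, k), (j, k, i), (k, i, j), (k, j, i)}" for i' j' k'
    using that by (elim insertE emptyE Pair_inject) (simp_all only: perms)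
  moreover have "(max i (max j k), max (min i j) (min (max i j) k), min i (min j k))
      \<in> {(i, j, k), (i, k, j), (j, i, k), (j, k, i), (k, i, j), (k, j, i)}"
    by (auto simp: max_def min_def)
  ultimately have "?M (max i (max j k)) (max (min i j) (min (max i j) k)) (min i (min j k)) = ?M i j k"
    by blast
  then show ?thesis by (simp add: sorted_monom3_def)
qed

text \<open>Folding merges monomials whose sums agree by symmetry, so a polynomial that cancels only
  after symmetrisation gets small coefficients, while its sum over triples is unchanged.\<close>

lemma inner_tsum_fold3: "inner_tsum X (\<lambda>u v t. ev3 u v t (fold3 0 p)) = inner_tsum X (\<lambda>u v t. ev3 u v t p)"
proof -
  have 1: "inner_tsum X (\<lambda>u v t. ev3 u v t (fold1 i j k p))
      = inner_tsum X (\<lambda>u v t. u ^ i * v ^ j * t ^ k * ev1 t p)" for i j k p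
  proof (induction p arbitrary: k)
    case (Cons a p)
    have "inner_tsum X (\<lambda>u v t. ev3 u v t (fold1 i j k (a # p)))
        = inner_tsum X (\<lambda>u v t. of_int a * u ^ i * v ^ j * t ^ k + u ^ i * v ^ j * t ^ Suc k * ev1 t p)"
      by (simp only: fold1.simps ev_add inner_tsum_add inner_tsum_sorted_monom3 Cons)
    then show ?case by (simp add: algebra_simps)
  qed (simp add: inner_tsum_zero)
  have 2: "inner_tsum X (\<lambda>u v t. ev3 u v t (fold2 i j p))
      = inner_tsum X (\<lambda>u v t. u ^ i * v ^ j * ev2 v t p)" for i j p
  proof (induction p arbitrary: j)
    case (Cons a p)
    have "inner_tsum X (\<lambda>u v t. ev3 u v t (fold2 i j (a # p)))
        = inner_tsum X (\<lambda>u v t. u ^ i * v ^ j * t ^ 0 * ev1 t a + u ^ i * v ^ Suc j * ev2 v t p)"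
      by (simp only: fold2.simps ev_add inner_tsum_add 1 Cons)
    then show ?case by (simp add: algebra_simps)
  qed (simp add: inner_tsum_zero)
  have "inner_tsum X (\<lambda>u v t. ev3 u v t (fold3 i p))
      = inner_tsum X (\<lambda>u v t. u ^ i * ev3 u v t p)" for i p
  proof (induction p arbitrary: i)
    case (Cons a p)
    have "inner_tsum X (\<lambda>u v t. ev3 u v t (fold3 i (a # p)))
        = inner_tsum X (\<lambda>u v t. u ^ i * v ^ 0 * ev2 v t a + u ^ Suc i * ev3 u v t p)"
      by (simp only: fold3.simps ev_add inner_tsum_add 2 Cons)
    then show ?case by (simp add: algebra_simps)
  qed (simp add: inner_tsum_zero)
  then show ?thesis by simp
qed

section \<open>Zonal kernels\<close>

definition psd_on :: "'a set \<Rightarrow> ('a \<Rightarrow> 'a \<Rightarrow> real) \<Rightarrow> bool" where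
  "psd_on X K \<longleftrightarrow> (\<forall>h. 0 \<le> (\<Sum>y\<in>X. \<Sum>z\<in>X. h y * h z * K y z))"

lemma psd_on_rank1: "psd_on X (\<lambda>y z. f y * f z)"
proof -
  have "(\<Sum>y\<in>X. \<Sum>z\<in>X. h y * h z * (f y * f z)) = (\<Sum>y\<in>X. h y * f y)\<^sup>2" for h
    unfolding power2_eq_square sum_product by (intro sum.cong) auto
  then show ?thesis by (simp add: psd_on_def)
qed

lemma psd_on_add: "psd_on X K \<Longrightarrow> psd_on X L \<Longrightarrow> psd_on X (\<lambda>y z. K y z + L y z)"
  by (simp add: psd_on_def distrib_left sum.distrib)

lemma psd_on_cmul:
  assumes "0 \<le> c" "psd_on X K"
  shows "psd_on X (\<lambda>y z. c * K y z)"
proof -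
  have "(\<Sum>y\<in>X. \<Sum>z\<in>X. h y * h z * (c * K y z)) = c * (\<Sum>y\<in>X. \<Sum>z\<in>X. h y * h z * K y z)" for h
    unfolding sum_distrib_left by (intro sum.cong) auto
  then show ?thesis using assms by (simp add: psd_on_def)
qed

lemma psd_on_cong:
  assumes "\<And>y z. y \<in> X \<Longrightarrow> z \<in> X \<Longrightarrow> K y z = L y z" "psd_on X L"
  shows "psd_on X K"
proof -
  have "(\<Sum>y\<in>X. \<Sum>z\<in>X. h y * h z * K y z) = (\<Sum>y\<in>X. \<Sum>z\<in>X. h y * h z * L y z)" for h
    using assms(1) by (intro sum.cong) auto
  then show ?thesis using assms(2) by (simp add: psd_on_def)
qed

text \<open>Legendre polynomials, homogenised and with denominators cleared: for vectors \<open>a, b\<close> in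
  three-space, \<open>leg k (a \<bullet> b) (\<bar>a\<bar>\<^sup>2 \<bar>b\<bar>\<^sup>2)\<close> is a multiple of \<open>\<bar>a\<bar>\<^sup>k \<bar>b\<bar>\<^sup>k P\<^sub>k(cos \<angle>(a, b))\<close>.\<close>

definition leg :: "nat \<Rightarrow> real \<Rightarrow> real \<Rightarrow> real" where
  "leg k w p = [1, w, 3 * w ^ 2 - p, 5 * w ^ 3 - 3 * w * p, 35 * w ^ 4 - 30 * w ^ 2 * p + 3 * p ^ 2] ! k"

lemma leg_simps [simp]:
  "leg 0 w p = 1" "leg 1 w p = w" "leg (Suc 0) w p = w" "leg 2 w p = 3 * w ^ 2 - p"
  "leg 3 w p = 5 * w ^ 3 - 3 * w * p" "leg 4 w p = 35 * w ^ 4 - 30 * w ^ 2 * p + 3 * p ^ 2"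
  by (simp_all add: leg_def)

text \<open>The addition theorem in coordinates: \<open>leg k\<close> is a positive combination of products of
  solid spherical harmonics of degree \<open>k\<close>.\<close>

lemma psd_on_leg:
  assumes k: "k < 5"
    and w: "\<And>y z. y \<in> X \<Longrightarrow> z \<in> X \<Longrightarrow> w y z = a y * a z + b y * b z + c y * c z"
    and p: "\<And>y z. y \<in> X \<Longrightarrow> z \<in> X \<Longrightarrow>
      p y z = ((a y)\<^sup>2 + (b y)\<^sup>2 + (c y)\<^sup>2) * ((a z)\<^sup>2 + (b z)\<^sup>2 + (c z)\<^sup>2)"
  shows "psd_on X (\<lambda>y z. leg k (w y z) (p y z))"
proof -
  let ?R = "\<lambda>f y z. f (a y) (b y) (c y) * f (a z) (b z) (c z) :: real"
  \<comment> \<open>Cases count from 1, so case 3 is degree 2. Degree \<open>k\<close> uses the 2k+1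
    solid harmonics about the third axis, by increasing azimuthal order; the weights are those of
    the addition theorem.\<close>
  consider "k = 0" | "k = 1" | "k = 2" | "k = 3" | "k = 4" using k by linarith
  then show ?thesis
  proof cases
    case 1
    show ?thesis unfolding 1 using psd_on_rank1[of X "\<lambda>_. 1"] by simp
  next
    case 2
    have "psd_on X (\<lambda>y z. ?R (\<lambda>x y z. x) y z + ?R (\<lambda>x y z. y) y z + ?R (\<lambda>x y z. z) y z)"
      by (intro psd_on_add psd_on_rank1)
    then show ?thesis unfolding 2 by (rule psd_on_cong[rotated]) (simp add: w)
  next
    case 3
    have "psd_on X (\<lambda>y z. 1/2 * ?R (\<lambda>x y z. 2 * z\<^sup>2 - x\<^sup>2 - y\<^sup>2) y z
      + 6 * ?R (\<lambda>x y z. x * z) y z + 6 * ?R (\<lambda>x y z. y * z) y z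
      + 3/2 * ?R (\<lambda>x y z. x\<^sup>2 - y\<^sup>2) y z + 6 * ?R (\<lambda>x y z. x * y) y z)"
      by (intro psd_on_add psd_on_cmul psd_on_rank1) simp_all
    then show ?thesis unfolding 3
      by (rule psd_on_cong[rotated])
        (simp only: leg_simps w p, algebra)
  next
    case 4
    have "psd_on X (\<lambda>y z. 1/2 * ?R (\<lambda>x y z. 2 * z^3 - 3 * z * (x\<^sup>2 + y\<^sup>2)) y z
      + 3/4 * ?R (\<lambda>x y z. x * (4 * z\<^sup>2 - x\<^sup>2 - y\<^sup>2)) y z + 3/4 * ?R (\<lambda>x y z. y * (4 * z\<^sup>2 - x\<^sup>2 - y\<^sup>2)) y z
      + 15/2 * ?R (\<lambda>x y z. z * (x\<^sup>2 - y\<^sup>2)) y z + 30 * ?R (\<lambda>x y z. x * y * z) y z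
      + 5/4 * ?R (\<lambda>x y z. x * (x\<^sup>2 - 3 * y\<^sup>2)) y z + 5/4 * ?R (\<lambda>x y z. y * (3 * x\<^sup>2 - y\<^sup>2)) y z)"
      by (intro psd_on_add psd_on_cmul psd_on_rank1) simp_all
    then show ?thesis unfolding 4
      by (rule psd_on_cong[rotated])
        (simp only: leg_simps w p, algebra)
  next
    case 5
    have "psd_on X (\<lambda>y z. 1/8 * ?R (\<lambda>x y z. 8 * z^4 - 24 * z\<^sup>2 * (x\<^sup>2 + y\<^sup>2) + 3 * (x\<^sup>2 + y\<^sup>2)\<^sup>2) y z
      + 5 * ?R (\<lambda>x y z. x * z * (4 * z\<^sup>2 - 3 * x\<^sup>2 - 3 * y\<^sup>2)) y z
      + 5 * ?R (\<lambda>x y z. y * z * (4 * z\<^sup>2 - 3 * x\<^sup>2 - 3 * y\<^sup>2)) y z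
      + 5/2 * ?R (\<lambda>x y z. (x\<^sup>2 - y\<^sup>2) * (6 * z\<^sup>2 - x\<^sup>2 - y\<^sup>2)) y z
      + 10 * ?R (\<lambda>x y z. x * y * (6 * z\<^sup>2 - x\<^sup>2 - y\<^sup>2)) y z
      + 35 * ?R (\<lambda>x y z. z * x * (x\<^sup>2 - 3 * y\<^sup>2)) y z + 35 * ?R (\<lambda>x y z. z * y * (3 * x\<^sup>2 - y\<^sup>2)) y z
      + 35/8 * ?R (\<lambda>x y z. x^4 - 6 * x\<^sup>2 * y\<^sup>2 + y^4) y z + 70 * ?R (\<lambda>x y z. x * y * (x\<^sup>2 - y\<^sup>2)) y z)"
      by (intro psd_on_add psd_on_cmul psd_on_rank1) simp_all
    then show ?thesis unfolding 5
      by (rule psd_on_cong[rotated])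
        (simp only: leg_simps w p, algebra)
  qed
qed

lemma inner_real4: "x \<bullet> y = x $ 1 * y $ 1 + x $ 2 * y $ 2 + x $ 3 * y $ 3 + x $ 4 * y $ 4"
  for x y :: "real ^ 4"
  by (simp add: inner_vec_def sum_4)

text \<open>Euler's four-square identity, polarised: the factors are the coordinates of the
  quaternion products of \<open>y\<close> and \<open>z\<close> with the conjugate of
  \<open>x\<close>, which scales inner products by the squared norm of \<open>x\<close>.\<close>

lemma quaternion_identity:
  fixes x1 x2 x3 x4 y1 y2 y3 y4 z1 z2 z3 z4 :: "'a::comm_ring_1"
  shows "(x1 * x1 + x2 * x2 + x3 * x3 + x4 * x4) * (y1 * z1 + y2 * z2 + y3 * z3 + y4 * z4) =
    (x1 * y1 + x2 * y2 + x3 * y3 + x4 * y4) * (x1 * z1 + x2 * z2 + x3 * z3 + x4 * z4)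
    + (x1 * y2 - x2 * y1 + x3 * y4 - x4 * y3) * (x1 * z2 - x2 * z1 + x3 * z4 - x4 * z3)
    + (x1 * y3 - x3 * y1 + x4 * y2 - x2 * y4) * (x1 * z3 - x3 * z1 + x4 * z2 - x2 * z4)
    + (x1 * y4 - x4 * y1 + x2 * y3 - x3 * y2) * (x1 * z4 - x4 * z1 + x2 * z3 - x3 * z2)"
  by (simp add: algebra_simps)

text \<open>Reading \<open>x\<close> as a unit quaternion, \<open>x, ix, jx, kx\<close> is an orthonormal basis; \<open>a, b, c\<close> below are the
  last three coordinates.\<close>

lemma psd_on_zonal:
  fixes x :: "real ^ 4"
  assumes k: "k < 5" and x: "norm x = 1" and X: "X \<subseteq> sphere 0 1"
  shows "psd_on X (\<lambda>y z. leg k (y \<bullet> z - (x \<bullet> y) * (x \<bullet> z)) ((1 - (x \<bullet> y)\<^sup>2) * (1 - (x \<bullet> z)\<^sup>2)))"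
proof -
  define a b c where "a y = x $ 1 * y $ 2 - x $ 2 * y $ 1 + x $ 3 * y $ 4 - x $ 4 * y $ 3"
    and "b y = x $ 1 * y $ 3 - x $ 3 * y $ 1 + x $ 4 * y $ 2 - x $ 2 * y $ 4"
    and "c y = x $ 1 * y $ 4 - x $ 4 * y $ 1 + x $ 2 * y $ 3 - x $ 3 * y $ 2" for y :: "real ^ 4"
  have id: "(x \<bullet> x) * (y \<bullet> z) = (x \<bullet> y) * (x \<bullet> z) + a y * a z + b y * b z + c y * c z" for y z
    unfolding inner_real4 a_def b_def c_def by (rule quaternion_identity)
  have "x \<bullet> x = 1" using x by (simp add: norm_eq_1)
  then have i: "y \<bullet> z - (x \<bullet> y) * (x \<bullet> z) = a y * a z + b y * b z + c y * c z" for y z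
    using id[of y z] by simp
  have "y \<bullet> y = 1" if "y \<in> X" for y using X that by (auto simp: norm_eq_1[symmetric])
  then have n: "1 - (x \<bullet> y)\<^sup>2 = (a y)\<^sup>2 + (b y)\<^sup>2 + (c y)\<^sup>2" if "y \<in> X" for y
    using i[of y y] that by (simp add: power2_eq_square)
  show ?thesis by (rule psd_on_leg[OF k i]) (simp add: n)
qed

text \<open>This is the Gram determinant of the three vectors, obtained from Cauchy-Schwarz for the
  projections of \<open>y\<close> and \<open>z\<close> to the complement of
  \<open>x\<close>.\<close>

lemma gram_det_nonneg:
  fixes x y z :: "'a::real_inner"
  assumes "norm x = 1" "norm y = 1" "norm z = 1"
  shows "0 \<le> 1 + 2 * (x \<bullet> y) * (x \<bullet> z) * (y \<bullet> z) - (x \<bullet> y)\<^sup>2 - (x \<bullet> z)\<^sup>2 - (y \<bullet> z)\<^sup>2"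
proof -
  have 1: "x \<bullet> x = 1" "y \<bullet> y = 1" "z \<bullet> z = 1" using assms by (simp_all add: norm_eq_1)
  define p q where "p = y - (x \<bullet> y) *\<^sub>R x" and "q = z - (x \<bullet> z) *\<^sub>R x"
  have "p \<bullet> q = y \<bullet> z - (x \<bullet> y) * (x \<bullet> z)" "p \<bullet> p = 1 - (x \<bullet> y)\<^sup>2" "q \<bullet> q = 1 - (x \<bullet> z)\<^sup>2"
    by (simp_all add: p_def q_def inner_diff_left inner_diff_right 1 inner_commute[of y x] inner_commute[of z x] power2_eq_square)
  then have "0 \<le> (1 - (x \<bullet> y)\<^sup>2) * (1 - (x \<bullet> z)\<^sup>2) - (y \<bullet> z - (x \<bullet> y) * (x \<bullet> z))\<^sup>2"
    using Cauchy_Schwarz_ineq[of p q] by simp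
  also have "\<dots> = 1 + 2 * (x \<bullet> y) * (x \<bullet> z) * (y \<bullet> z) - (x \<bullet> y)\<^sup>2 - (x \<bullet> z)\<^sup>2 - (y \<bullet> z)\<^sup>2"
    by algebra
  finally show ?thesis .
qed

lemma psd_on_sum_list:
  "(\<And>a. a \<in> set as \<Longrightarrow> psd_on X (K a)) \<Longrightarrow> psd_on X (\<lambda>y z. \<Sum>a\<leftarrow>as. K a y z)"
proof (induction as)
  case Nil
  show ?case by (simp add: psd_on_def)
next
  case (Cons a as)
  then show ?case by (auto intro!: psd_on_add)
qed

text \<open>The weight \<open>g\<close> is absorbed into the test function \<open>h\<close>.\<close>

lemma psd_on_weight:
  assumes "psd_on X K"
  shows "psd_on X (\<lambda>y z. g y * g z * K y z)"
  unfolding psd_on_def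
proof
  fix h
  have "0 \<le> (\<Sum>y\<in>X. \<Sum>z\<in>X. (h y * g y) * (h z * g z) * K y z)"
    using assms by (auto simp: psd_on_def)
  then show "0 \<le> (\<Sum>y\<in>X. \<Sum>z\<in>X. h y * h z * (g y * g z * K y z))"
    by (simp add: mult_ac)
qed

section \<open>The certificate\<close>

text \<open>The data come from a numerical solution of the semidefinite program, by rounding Cholesky
  factors scaled by \<open>2^28\<close>. The entry \<open>kernel_vectors ! k\<close> lists the polynomials \<open>g\<close> that
  occur with the Legendre kernel of degree \<open>k\<close>, \<open>pair_shift\<close> is \<open>c\<close>, the polynomials in \<open>edge_squares\<close> and
  \<open>gram_squares\<close> are those squared in \<open>\<sigma>\<close> and \<open>\<tau>\<close>, and the pair inequality uses \<open>pair_squares\<close> with weight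
  1 and \<open>pair_interval_squares\<close> with weight \<open>(1 + u) (1 - 2u)\<close>.\<close>

definition kernel_vectors :: "int list list list" where
  "kernel_vectors = [[[454371, -10220314, -24178345, -17360936, 25006125, 86267478, 27534047], [-2653184,
    -2289837, -7679180, -7132638, -18663260, 0, 80844491], [-4858073, -28981023, 20771355, 49756200, -2702360,
    0, 0]], [[-8025766, 5192692, -21493746, 21452299, 108286863, 31117717], [4459291, 14505354, -12406650,
    -23731923, 0, 98644051], [-6247477, -40571702, -3115124, 75439085, 0, 0], [1157507, -4251139, 26705892, 0,
    0, 0]], [[-8195224, -15280758, 13744340, 44767642, 53632604], [4930809, 12140520, 31818512, -4819926, 0],
    [-979394, 7431838, 0, -3548031, 0]], [[-10208164, -29936467, 8658420, 34523123]], [[3302513, 11195413,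
    -2114984]]]"

definition pair_shift :: "int list" where
  "pair_shift = [26270858427336, -26105400971129, 63229835368325, -647274637201044, -944491725719286,
    1736055894633312, 2279447502080872, -1273067982147452, -1625888260890439, 1471393044129174,
    2589809268570934, 927154679890476]"

definition edge_squares :: "poly3 list" where
  "edge_squares = [[[[1503438, 4813684, -8001566, -8425870, -2995354, -2560110], [4813684, 8013863, -21586784,
    -15152453, -4241127], [-8001566, -21586784, 49011417, 43739106], [-8425870, -15152453, 43739106],
    [-2995354, -4241127], [-2560110]], [[9306410, 13123079, -30896078, -23354459, -3092496], [13123079,
    -4690121, -29078715, 2633073], [-30896078, -29078715, 124308188], [-23354459, 2633073], [-3092496]],
    [[18390237, 8109082, -20631590, -20442981], [8109082, -12293658, -108678], [-20631590, -108678],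
    [-20442981]], [[19095038, 2533583, -4970352], [2533583, -1993228], [-4970352]], [[7509186, 2707768],
    [2707768]], [[-386119]]], [[[153372, -2636162, 2973264, 8688959, -3506384, -9500153], [-2636162, 12183148,
    13080234, -24442444, -20757956], [2973264, 13080234, -26202616, -6805701], [8688959, -24442444, -6805701],
    [-3506384, -20757956], [-9500153]], [[9477576, -6353993, -25460144, -11910008, 9870331], [-6353993,
    3234805, 38718939, 12958905], [-25460144, 38718939], [-11910008, 12958905], [9870331]], [[6285699,
    -12253066, -16721925, -19123087], [-12253066, 46235893, 38562117], [-16721925, 38562117], [-19123087]],
    [[-14061691, -13350738, 15740117], [-13350738, 52556489], [15740117]], [[-13016765, -4215093],
    [-4215093]], [[-3226214]]], [[[-490382, -3397277, -5014752, 11827242, 23641484, 11399425], [-3397277,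
    3567968, -3969750, -9556982, -8274786], [-5014752, -3969750, 10996310, 15638503], [11827242, -9556982,
    15638503], [23641484, -8274786], [11399425]], [[-821432, -13508433, 16542024, 46018823, 7953399],
    [-13508433, 5433205, -16967858, -16365252], [16542024, -16967858], [46018823, -16365252], [7953399]],
    [[10831288, -13756966, 14708375, 29439293], [-13756966, 398874, -23274932], [14708375, -23274932],
    [29439293]], [[2140718, -53504, -5035782], [-53504], [-5035782]], [[-27586466, 4890540], [4890540]],
    [[-17766703]]], [[[56919, -481256, -1650477, 1955347, 3540228, 206890], [-481256, 5411360, -2179242,
    -9682694, -3944569], [-1650477, -2179242, 2073568, 11605167], [1955347, -9682694, 11605167], [3540228,
    -3944569], [206890]], [[1980923, -4323893, -5278001, 0, 265200], [-4323893, 12867917, 4881964, -12899875],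
    [-5278001, 4881964], [0, -12899875], [265200]], [[9273905, -16721649, -11940278, -3872147], [-16721649,
    9303440, 12151699], [-11940278, 12151699], [-3872147]], [[22153586, -20333467, -8949449], [-20333467],
    [-8949449]], [[26386751, -6495724], [-6495724]], [[11720241]]], [[[288, 675, -4202, -371, 8436, 4311],
    [675, 5688, -9879, -12166, -3659], [-4202, -9879, 12600, 29738], [-371, -12166, 29738], [8436, -3659],
    [4311]], [[2590, 1208, -503, 0, -1648], [1208, 7436, -14148, -13995], [-503, -14148], [0, -13995],
    [-1648]], [[12934, -1125, -8749, -6361], [-1125, 1938, -13874], [-8749, -13874], [-6361]], [[13744, -1658,
    -8788], [-1658], [-8788]], [[0, 2616], [2616]], [[-3204]]], [[[-45, -575, 680, 1352, -1693, -2584], [-575,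
    1502, 2698, -2529, -2017], [680, 2698, -3085], [1352, -2529], [-1693, -2017], [-2584]], [[487, -3934,
    -3227, 0, 1473], [-3934, 777, 17098, 2905], [-3227, 17098], [0, 2905], [1473]], [[-1157, -11135, -2090,
    3203], [-11135, 2706, 24375], [-2090, 24375], [3203]], [[-1943, -9730, 315], [-9730], [315]], [[0, -2340],
    [-2340]], [[229]]], [[[-117, 1082, 1090, -4100, -4490, 12], [1082, -3421, -1131, 6717, 4264], [1090,
    -1131, 4015], [-4100, 6717], [-4490, 4264], [12]], [[-4092, 1621, 9971, 0, -5446], [1621, -5608, 42,
    7781], [9971, 42], [0, 7781], [-5446]], [[-9507, 992, 17480, 9764], [992, -2480], [17480], [9764]],
    [[-5927, -1514, 9193], [-1514], [9193]], [[0, -3813], [-3813]], [[542]]], [[[-41, 308, 375, -1107, -1830,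
    -763], [308, -3064, -102, 5222, 2306], [375, -102, 1301], [-1107, 5222], [-1830, 2306], [-763]], [[-755,
    1233, -244, 0, 1550], [1233, -12782, 2675, 15423], [-244, 2675], [0, 15423], [1550]], [[-1767, 2979, 0,
    4249], [2979, -7816], [], [4249]], [[-1329, -6, 1381], [-6], [1381]], [[0, -2793], [-2793]], [[297]]],
    [[[6, -89, 74, 71, -482, -640], [-89, -949, 123, 2005, 1817], [74, 123, 56], [71, 2005], [-482, 1817],
    [-640]], [[-25, 746, -820, 0, 1953], [746, 689, 954], [-820, 954], [], [1953]], [[-348, 6821, 0, -2344],
    [6821, 1119], [], [-2344]], [[-470, 12607, 434], [12607], [434]], [[0, 7470], [7470]], [[-31]]], [[[0,
    -1074017, -176445, 2068347, 5184540, 3097093], [1074017, 0, -4365436, 581342, 8228523], [176445, 4365436,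
    0, 3216776], [-2068347, -581342, -3216776], [-5184540, -8228523], [-3097093]], [[0, -1505909, 3239022,
    -123877, 3623861], [1505909, 0, -20613195, -22016027], [-3239022, 20613195], [123877, 22016027],
    [-3623861]], [[0, 6414580, 5992964, -14759347], [-6414580, 0, -24876483], [-5992964, 24876483],
    [14759347]], [[0, 9238066, 83383], [-9238066], [-83383]], [[0, 3662433], [-3662433]]], [[[0, 1966507,
    3628853, -5859314, -15700646, -8033997], [-1966507, 0, 960631, 1953996, 2180309], [-3628853, -960631, 0,
    3254543], [5859314, -1953996, -3254543], [15700646, -2180309], [8033997]], [[0, -1959988, 3597072,
    6104892, 519187], [1959988, 0, 3078241, 4440857], [-3597072, -3078241], [-6104892, -4440857], [-519187]],
    [[0, -4393843, 8191085, 8601434], [4393843], [-8191085], [-8601434]], [[0, -1402990, 3168186], [1402990],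
    [-3168186]], [[0, -320228], [320228]]], [[[0, 1717, -1650, -4431, 0, 1014], [-1717, 0, 3563, 8932, 5742],
    [1650, -3563, 0, 6395], [4431, -8932, -6395], [0, -5742], [-1014]], [[0, -72, -5279, -3558, 2346], [72, 0,
    6189, 8462], [5279, -6189], [3558, -8462], [-2346]], [[0, -9904, -2860, -2201], [9904], [2860], [2201]],
    [[0, -15453, -759], [15453], [759]], [[0, -7384], [7384]]], [[[0, -683, 8, 1600, 0, -679], [683, 0, -1333,
    -2169, -2040], [-8, 1333, 0, -3137], [-1600, 2169, 3137], [0, 2040], [679]], [[0, -738, -4329, -1264,
    -597], [738, 0, -2235, -121], [4329, 2235], [1264, 121], [597]], [[0, -577, -14224, -1295], [577],
    [14224], [1295]], [[0, 0, -9773], [], [9773]], [[0, 597], [-597]]]]"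

definition gram_squares :: "poly3 list" where
  "gram_squares = [[[[262444, 1680244, -4016965, -321747, 1174630], [1680244, 239622, -7813572, -3780028],
    [-4016965, -7813572, 27634910], [-321747, -3780028], [1174630]], [[1680244, 239622, -7813572, -3780028],
    [239622, -26030311, 28558236], [-7813572, 28558236], [-3780028]], [[-4016965, -7813572, 27634910],
    [-7813572, 28558236], [27634910]], [[-321747, -3780028], [-3780028]], [[1174630]]], [[[0, -3343180,
    -1594276, 11476698, 12190465], [3343180, 0, -3554112, -2727117], [1594276, 3554112], [-11476698, 2727117],
    [-12190465]], [[0, -256910, -1082161, -2062908], [256910, 0, -11106327], [1082161, 11106327], [2062908]],
    [[0, 2471951, -5528914], [-2471951], [5528914]], [[0, 664209], [-664209]]]]"

definition pair_squares :: "int list list" where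
  "pair_squares = [[41063, -3128231, -26681522, -36800598, 81672146, 195907798, 100947238], [-434, -5186,
    -8740, 21956, 44394, 0, -19084]]"

definition pair_interval_squares :: "int list list" where
  "pair_interval_squares = [[28988, -2241171, -16623415, -9388243, 67153466, 71380478], [-289, -752, 13617,
    48128, 37996, 0], [408, 5145, 12358, 0, -10250, 0]]"


text \<open>Here \<open>w\<close> encodes \<open>t - u v\<close> and \<open>p\<close> encodes
  \<open>(1 - u^2) (1 - v^2)\<close>.\<close>

definition leg_poly :: "nat \<Rightarrow> poly3" where
  "leg_poly k = (let w = [[[0, 1]], [[], [-1]]]; p = [[[1], [], [-1]], [], [[-1], [], [1]]] in
     [[[[1]]], w, add3 (mul3 [[[3]]] (sq3 w)) (mul3 [[[-1]]] p),
      mul3 w (add3 (mul3 [[[5]]] (sq3 w)) (mul3 [[[-3]]] p)),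
      add3 (mul3 [[[35]]] (sq3 (sq3 w))) (add3 (mul3 [[[-30]]] (mul3 (sq3 w) p)) (mul3 [[[3]]] (sq3 p)))] ! k)"

definition kernel_poly :: poly3 where
  "kernel_poly = sum3 (map (\<lambda>k. mul3 (leg_poly k)
     (sum3 (map (\<lambda>g. mul3 (in_first g) (in_second g)) (kernel_vectors ! k)))) [0, 1, 2, 3, 4])"

text \<open>The residual of the certificate identity. It is meant to be small only after folding,
  since the identity uses the symmetry in the three variables.\<close>

definition triple_poly :: poly3 where
  "triple_poly = add3 kernel_poly (add3 (in_first pair_shift)
     (add3 (mul3 [[[1]], [[-2]]] (sum3 (map sq3 edge_squares)))
           (mul3 [[[1, 0, -1], [], [-1]], [[], [0, 2]], [[-1]]] (sum3 (map sq3 gram_squares)))))"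

text \<open>On the diagonal \<open>w = s\<close> and \<open>p = s^2\<close>, so homogeneity leaves
  the value of \<open>leg k\<close> at (1, 1), namely 1, 1, 2, 2, 8, times
  \<open>s^k\<close>.\<close>

definition leg_diag_poly :: "nat \<Rightarrow> int list" where
  "leg_diag_poly k = (let s = [1, 0, -1] in
     [[1], s, mul1 [2] (sq1 s), mul1 [2] (mul1 s (sq1 s)), mul1 [8] (sq1 (sq1 s))] ! k)"

definition kernel_at_1_poly :: "int list" where
  "kernel_at_1_poly = sum1 (map (\<lambda>g. mul1 [sum_list g] g) (kernel_vectors ! 0))"

definition kernel_diag_poly :: "int list" where
  "kernel_diag_poly =
     sum1 (map (\<lambda>k. mul1 (leg_diag_poly k) (sum1 (map sq1 (kernel_vectors ! k)))) [0, 1, 2, 3, 4])"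

text \<open>The coefficient -23 pays for moving \<open>pair_shift\<close> into the triples,
  \<open>[1, -1, -2]\<close> is \<open>(1 + u) (1 - 2u)\<close>, and the large constant is the
  margin gained from each ordered pair.\<close>

definition pair_poly :: "int list" where
  "pair_poly = sum1
    [mul1 [2] kernel_at_1_poly, kernel_diag_poly, mul1 [-23] pair_shift, [444004802733121],
     sum1 (map sq1 pair_squares), mul1 [1, -1, -2] (sum1 (map sq1 pair_interval_squares))]"

lemma norm3_triple_poly: "norm3 (fold3 0 triple_poly) \<le> 38182841072"
  by code_simp

lemma norm3_pair_poly: "norm3 (in_first pair_poly) \<le> 11580868025"
  by code_simp

text \<open>The left side is the kernel at (1, 1, 1), the contribution of one fully coincident
  triple.\<close>

lemma kernel_at_1: "(\<Sum>g\<leftarrow>kernel_vectors ! 0. (sum_list g)\<^sup>2) \<le> 10611728219260941"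
  by code_simp

section \<open>The kernel and its values on coincident points\<close>

definition kernel_fun :: "real \<Rightarrow> real \<Rightarrow> real \<Rightarrow> real" where
  "kernel_fun u v t = (\<Sum>k\<leftarrow>[0, 1, 2, 3, 4]. \<Sum>g\<leftarrow>kernel_vectors ! k.
     ev1 u g * ev1 v g * leg k (t - u * v) ((1 - u\<^sup>2) * (1 - v\<^sup>2)))"

lemma ev_leg_poly:
  assumes "k < 5"
  shows "ev3 u v t (leg_poly k) = leg k (t - u * v) ((1 - u\<^sup>2) * (1 - v\<^sup>2))"
proof -
  have "ev3 u v t (leg_poly 0) = leg 0 (t - u * v) ((1 - u\<^sup>2) * (1 - v\<^sup>2))"
    "ev3 u v t (leg_poly 1) = leg 1 (t - u * v) ((1 - u\<^sup>2) * (1 - v\<^sup>2))"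
    by (simp_all add: leg_poly_def)
  moreover have "ev3 u v t (leg_poly 2) = leg 2 (t - u * v) ((1 - u\<^sup>2) * (1 - v\<^sup>2))"
    by (simp add: leg_poly_def Let_def) algebra
  moreover have "ev3 u v t (leg_poly 3) = leg 3 (t - u * v) ((1 - u\<^sup>2) * (1 - v\<^sup>2))"
    by (simp add: leg_poly_def Let_def) algebra
  moreover have "ev3 u v t (leg_poly 4) = leg 4 (t - u * v) ((1 - u\<^sup>2) * (1 - v\<^sup>2))"
    by (simp add: leg_poly_def Let_def) algebra
  moreover have "k = 0 \<or> k = 1 \<or> k = 2 \<or> k = 3 \<or> k = 4" using assms by linarith
  ultimately show ?thesis by (elim disjE) (simp_all only:)
qed

lemma ev_leg_diag_poly:
  assumes "k < 5"
  shows "ev1 u (leg_diag_poly k) = leg k (1 - u * u) ((1 - u\<^sup>2) * (1 - u\<^sup>2))"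
proof -
  have "ev1 u (leg_diag_poly 0) = leg 0 (1 - u * u) ((1 - u\<^sup>2) * (1 - u\<^sup>2))"
    "ev1 u (leg_diag_poly 1) = leg 1 (1 - u * u) ((1 - u\<^sup>2) * (1 - u\<^sup>2))"
    by (simp_all add: leg_diag_poly_def)
  moreover have "ev1 u (leg_diag_poly 2) = leg 2 (1 - u * u) ((1 - u\<^sup>2) * (1 - u\<^sup>2))"
    by (simp add: leg_diag_poly_def Let_def) algebra
  moreover have "ev1 u (leg_diag_poly 3) = leg 3 (1 - u * u) ((1 - u\<^sup>2) * (1 - u\<^sup>2))"
    by (simp add: leg_diag_poly_def Let_def) algebra
  moreover have "ev1 u (leg_diag_poly 4) = leg 4 (1 - u * u) ((1 - u\<^sup>2) * (1 - u\<^sup>2))"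
    by (simp add: leg_diag_poly_def Let_def) algebra
  moreover have "k = 0 \<or> k = 1 \<or> k = 2 \<or> k = 3 \<or> k = 4" using assms by linarith
  ultimately show ?thesis by (elim disjE) (simp_all only:)
qed

lemma ev_kernel_poly: "ev3 u v t kernel_poly = kernel_fun u v t"
proof -
  have "ev3 u v t (mul3 (leg_poly k) (sum3 (map (\<lambda>g. mul3 (in_first g) (in_second g)) (kernel_vectors ! k))))
    = (\<Sum>g\<leftarrow>kernel_vectors ! k. ev1 u g * ev1 v g * leg k (t - u * v) ((1 - u\<^sup>2) * (1 - v\<^sup>2)))"
    if "k < 5" for k
    by (simp add: ev_leg_poly[OF that] sum_list_mult_const o_def mult.commute)
  then show ?thesis by (simp add: kernel_poly_def kernel_fun_def del: ev_mul)
qed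

lemma of_int_sum_list: "of_int (\<Sum>a\<leftarrow>as. f a) = (\<Sum>a\<leftarrow>as. of_int (f a))"
  by (induction as) auto

lemma ev1_at_1: "ev1 1 g = of_int (sum_list g)"
  by (induction g) auto

text \<open>Both arguments of \<open>leg\<close> vanish here, so only degree 0 survives;
  \<open>sum_list g\<close> is the value of \<open>g\<close> at 1.\<close>

lemma kernel_fun_at_1:
  "kernel_fun 1 u u = ev1 u kernel_at_1_poly" "kernel_fun u 1 u = ev1 u kernel_at_1_poly"
  by (simp_all add: kernel_fun_def kernel_at_1_poly_def ev1_at_1 o_def mult.commute)

lemma kernel_fun_diag: "kernel_fun u u 1 = ev1 u kernel_diag_poly"
  by (simp add: kernel_fun_def kernel_diag_poly_def ev_leg_diag_poly sum_list_mult_const o_def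
      power2_eq_square[of "ev1 u _"] mult.commute)

lemma sum_list_squares_nonneg: "0 \<le> (\<Sum>p\<leftarrow>ps. (f p)\<^sup>2)" for f :: "'a \<Rightarrow> real"
  by (induction ps) auto

lemma kernel_fun_sum_nonneg:
  fixes X :: "(real ^ 4) set"
  assumes "X \<subseteq> sphere 0 1"
  shows "0 \<le> (\<Sum>x\<in>X. \<Sum>y\<in>X. \<Sum>z\<in>X. kernel_fun (x \<bullet> y) (x \<bullet> z) (y \<bullet> z))"
proof (rule sum_nonneg)
  fix x assume "x \<in> X"
  then have "norm x = 1" using assms by auto
  then have "psd_on X (\<lambda>y z. kernel_fun (x \<bullet> y) (x \<bullet> z) (y \<bullet> z))"
    unfolding kernel_fun_def
    by (intro psd_on_sum_list psd_on_weight psd_on_zonal assms) auto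
  then show "0 \<le> (\<Sum>y\<in>X. \<Sum>z\<in>X. kernel_fun (x \<bullet> y) (x \<bullet> z) (y \<bullet> z))"
    \<comment> \<open>The constant function 1 serves as test function.\<close>
    unfolding psd_on_def by (elim allE[of _ "\<lambda>_. 1"]) simp
qed

lemma triple_inequality:
  fixes X :: "'a::real_inner set"
  assumes "finite X" "card X = 25" "X \<subseteq> sphere 0 1" "pairwise (\<lambda>x y. x \<bullet> y \<le> 1/2) X"
  shows "inner_tsum X kernel_fun + 23 * psum X (\<lambda>x y. ev1 (x \<bullet> y) pair_shift) \<le> 25 * 24 * 23 * 38182841072"
proof -
  have n: "norm x = 1" if "x \<in> X" for x using assms(3) that by auto
  have b: "\<bar>x \<bullet> y\<bar> \<le> 1" if "x \<in> X" "y \<in> X" for x y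
    using Cauchy_Schwarz_ineq2[of x y] n that by simp
  have ev: "ev3 u v t triple_poly = kernel_fun u v t + ev1 u pair_shift
      + ((1 - 2 * u) * (\<Sum>p\<leftarrow>edge_squares. (ev3 u v t p)\<^sup>2)
      + (1 + 2 * u * v * t - u\<^sup>2 - v\<^sup>2 - t\<^sup>2) * (\<Sum>p\<leftarrow>gram_squares. (ev3 u v t p)\<^sup>2))" for u v t
    by (simp add: triple_poly_def ev_kernel_poly o_def power2_eq_square algebra_simps)
  \<comment> \<open>The shift depends only on \<open>x\<close> and \<open>y\<close>, so 23 times its
    pair sum is its sum over triples.\<close>
  have "inner_tsum X kernel_fun + 23 * psum X (\<lambda>x y. ev1 (x \<bullet> y) pair_shift)
      = inner_tsum X (\<lambda>u v t. kernel_fun u v t + ev1 u pair_shift)"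
    using tsum_pair[OF assms(1), of "\<lambda>x y. ev1 (x \<bullet> y) pair_shift"] assms(2)
    by (simp add: inner_tsum_def tsum_add)
  also have "\<dots> \<le> inner_tsum X (\<lambda>u v t. ev3 u v t triple_poly)"
    unfolding inner_tsum_def
  proof (rule tsum_mono)
    fix x y z assume X: "x \<in> X" "y \<in> X" "z \<in> X" "x \<noteq> y"
    then have "x \<bullet> y \<le> 1/2" using assms(4) by (auto simp: pairwise_def)
    then show "kernel_fun (x \<bullet> y) (x \<bullet> z) (y \<bullet> z) + ev1 (x \<bullet> y) pair_shift
        \<le> ev3 (x \<bullet> y) (x \<bullet> z) (y \<bullet> z) triple_poly"
      unfolding ev using gram_det_nonneg[of x y z] X n
      by (intro order_trans[OF _ add_left_mono[OF add_nonneg_nonneg]] mult_nonneg_nonneg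
          sum_list_squares_nonneg) auto
  qed
  also have "\<dots> = inner_tsum X (\<lambda>u v t. ev3 u v t (fold3 0 triple_poly))"
    by (rule inner_tsum_fold3[symmetric])
  also have "\<dots> \<le> tsum X (\<lambda>x y z. 38182841072)"
    unfolding inner_tsum_def
  proof (rule tsum_mono)
    fix x y z assume "x \<in> X" "y \<in> X" "z \<in> X"
    then have "\<bar>ev3 (x \<bullet> y) (x \<bullet> z) (y \<bullet> z) (fold3 0 triple_poly)\<bar> \<le> of_int (norm3 (fold3 0 triple_poly))"
      by (intro abs_ev3_le b)
    moreover have "real_of_int (norm3 (fold3 0 triple_poly)) \<le> of_int 38182841072"
      using norm3_triple_poly by (simp only: of_int_le_iff)
    ultimately show "ev3 (x \<bullet> y) (x \<bullet> z) (y \<bullet> z) (fold3 0 triple_poly) \<le> 38182841072" by simp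
  qed
  also have "\<dots> = 25 * 24 * 23 * 38182841072"
    using tsum_pair[OF assms(1), of "\<lambda>x y. 38182841072"] psum_const[OF assms(1)] assms(2) by simp
  finally show ?thesis .
qed

lemma pair_inequality:
  fixes X :: "'a::real_inner set"
  assumes "finite X" "card X = 25" "X \<subseteq> sphere 0 1" "pairwise (\<lambda>x y. x \<bullet> y \<le> 1/2) X"
  shows "psum X (\<lambda>x y. kernel_fun 1 (x \<bullet> y) (x \<bullet> y) + kernel_fun (x \<bullet> y) 1 (x \<bullet> y)
      + kernel_fun (x \<bullet> y) (x \<bullet> y) 1) - 23 * psum X (\<lambda>x y. ev1 (x \<bullet> y) pair_shift)
    \<le> 25 * 24 * (11580868025 - 444004802733121)"
proof -
  let ?f = "\<lambda>u. kernel_fun 1 u u + kernel_fun u 1 u + kernel_fun u u 1"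
  \<comment> \<open>The shift is added with the factor \<open>- 23\<close> rather than subtracted,
    to match \<open>psum_add\<close> and \<open>psum_cmul\<close>.\<close>
  have ev: "ev1 u pair_poly = ?f u + (- 23) * ev1 u pair_shift + 444004802733121
      + ((\<Sum>p\<leftarrow>pair_squares. (ev1 u p)\<^sup>2)
      + (1 + u) * (1 - 2 * u) * (\<Sum>p\<leftarrow>pair_interval_squares. (ev1 u p)\<^sup>2))" for u
    by (simp add: pair_poly_def kernel_fun_diag kernel_fun_at_1 o_def algebra_simps)
  have "?f (x \<bullet> y) + (- 23) * ev1 (x \<bullet> y) pair_shift \<le> 11580868025 - 444004802733121"
    if X: "x \<in> X" "y \<in> X" "x \<noteq> y" for x y
  proof -
    have "norm x = 1" "norm y = 1" using assms(3) X by auto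
    then have b: "\<bar>x \<bullet> y\<bar> \<le> 1" using Cauchy_Schwarz_ineq2[of x y] by simp
    have "x \<bullet> y \<le> 1/2" using assms(4) X by (auto simp: pairwise_def)
    then have "0 \<le> 1 - 2 * (x \<bullet> y)" "0 \<le> 1 + x \<bullet> y" using b by linarith+
    then have "0 \<le> (\<Sum>p\<leftarrow>pair_squares. (ev1 (x \<bullet> y) p)\<^sup>2) + (1 + x \<bullet> y) * (1 - 2 * (x \<bullet> y)) *
        (\<Sum>p\<leftarrow>pair_interval_squares. (ev1 (x \<bullet> y) p)\<^sup>2)"
      by (intro add_nonneg_nonneg[OF sum_list_squares_nonneg]
          mult_nonneg_nonneg[OF mult_nonneg_nonneg sum_list_squares_nonneg])
    \<comment> \<open>The univariate residual is read as a polynomial in three variables, the last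
      two set to 0, to reuse the coefficient bound.\<close>
    moreover have "\<bar>ev3 (x \<bullet> y) 0 0 (in_first pair_poly)\<bar> \<le> of_int (norm3 (in_first pair_poly))"
      by (intro abs_ev3_le b) simp_all
    moreover have "real_of_int (norm3 (in_first pair_poly)) \<le> of_int 11580868025"
      using norm3_pair_poly by (simp only: of_int_le_iff)
    ultimately show ?thesis using ev[of "x \<bullet> y"] by simp
  qed
  then have "psum X (\<lambda>x y. ?f (x \<bullet> y) + (- 23) * ev1 (x \<bullet> y) pair_shift) \<le> psum X (\<lambda>x y. 11580868025 - 444004802733121)"
    by (intro psum_mono)
  then show ?thesis unfolding psum_add psum_cmul psum_const[OF assms(1)] assms(2) by simp
qed

lemma no_25_points:
  fixes X :: "(real ^ 4) set"
  assumes "finite X" "card X = 25" "X \<subseteq> sphere 0 1" "pairwise (\<lambda>x y. x \<bullet> y \<le> 1/2) X"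
  shows False
proof -
  have 1: "x \<bullet> x = 1" if "x \<in> X" for x using assms(3) that by (auto simp: norm_eq_1[symmetric])
  have "0 \<le> (\<Sum>x\<in>X. kernel_fun (x \<bullet> x) (x \<bullet> x) (x \<bullet> x))
      + psum X (\<lambda>x y. kernel_fun (x \<bullet> x) (x \<bullet> y) (x \<bullet> y) + kernel_fun (x \<bullet> y) (x \<bullet> x) (y \<bullet> x)
          + kernel_fun (x \<bullet> y) (x \<bullet> y) (y \<bullet> y))
      + inner_tsum X kernel_fun"
    using kernel_fun_sum_nonneg[OF assms(3)] sum_triples_split[OF assms(1),
        of "\<lambda>x y z. kernel_fun (x \<bullet> y) (x \<bullet> z) (y \<bullet> z)"]
    by (simp add: inner_tsum_def)
  also have "(\<Sum>x\<in>X. kernel_fun (x \<bullet> x) (x \<bullet> x) (x \<bullet> x)) = 25 * kernel_fun 1 1 1"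
    using 1 assms(2) by simp
  also have "psum X (\<lambda>x y. kernel_fun (x \<bullet> x) (x \<bullet> y) (x \<bullet> y) + kernel_fun (x \<bullet> y) (x \<bullet> x) (y \<bullet> x)
          + kernel_fun (x \<bullet> y) (x \<bullet> y) (y \<bullet> y))
      = psum X (\<lambda>x y. kernel_fun 1 (x \<bullet> y) (x \<bullet> y) + kernel_fun (x \<bullet> y) 1 (x \<bullet> y)
          + kernel_fun (x \<bullet> y) (x \<bullet> y) 1)"
    unfolding psum_def using 1 by (intro sum.cong refl) (auto simp: inner_commute)
  \<comment> \<open>The two multiples of the pair sum of \<open>pair_shift\<close> cancel.\<close>
  finally have "0 \<le> 25 * kernel_fun 1 1 1 + 25 * 24 * (11580868025 - 444004802733121) + 25 * 24 * 23 * 38182841072"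
    using pair_inequality[OF assms] triple_inequality[OF assms] by linarith
  moreover have "kernel_fun 1 1 1 \<le> 10611728219260941"
  proof -
    have "kernel_fun 1 1 1 = of_int (\<Sum>g\<leftarrow>kernel_vectors ! 0. (sum_list g)\<^sup>2)"
      by (simp add: kernel_fun_at_1 kernel_at_1_poly_def o_def)
        (simp add: ev1_at_1 of_int_sum_list power2_eq_square)
    also have "\<dots> \<le> of_int 10611728219260941" using kernel_at_1 by (simp only: of_int_le_iff)
    finally show ?thesis by simp
  qed
  \<comment> \<open>The coincident triples give at most about 2.653e17, the pairs at most about
    -2.664e17 and the distinct triples at most about 5.3e14, leaving less than -5e14.\<close>
  ultimately show False by simp
qed

section \<open>The 24 Hurwitz units\<close>

text \<open>Coordinates are doubled to stay integral, so the inner products 1 and 1/2 become 4 and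
  2.\<close>

definition hurwitz_doubled :: "(int \<times> int \<times> int \<times> int) list" where
  "hurwitz_doubled =
     [(2,0,0,0), (-2,0,0,0), (0,2,0,0), (0,-2,0,0), (0,0,2,0), (0,0,-2,0), (0,0,0,2), (0,0,0,-2)]
     @ List.product [1, -1] (List.product [1, -1] (List.product [1, -1] [1, -1]))"

definition half_vector :: "int \<times> int \<times> int \<times> int \<Rightarrow> real ^ 4" where
  "half_vector = (\<lambda>(a, b, c, d). vector [of_int a / 2, of_int b / 2, of_int c / 2, of_int d / 2])"

definition inner4 :: "int \<times> int \<times> int \<times> int \<Rightarrow> int \<times> int \<times> int \<times> int \<Rightarrow> int" where
  "inner4 = (\<lambda>(a, b, c, d) (a', b', c', d'). a * a' + b * b' + c * c' + d * d')"

lemma vector_4: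
  "(vector [a, b, c, d] :: 'a::zero ^ 4) $ 1 = a" "(vector [a, b, c, d] :: 'a ^ 4) $ 2 = b"
  "(vector [a, b, c, d] :: 'a ^ 4) $ 3 = c" "(vector [a, b, c, d] :: 'a ^ 4) $ 4 = d"
  unfolding vector_def by auto

lemma inner_half_vector: "half_vector p \<bullet> half_vector q = of_int (inner4 p q) / 4"
  by (cases p; cases q) (simp add: half_vector_def inner4_def inner_real4 vector_4 add_divide_distrib)

lemma hurwitz_inner:
  "distinct hurwitz_doubled \<and> length hurwitz_doubled = 24 \<and>
   list_all (\<lambda>p. list_all (\<lambda>q. if p = q then inner4 p q = 4 else inner4 p q \<le> 2) hurwitz_doubled) hurwitz_doubled"
  by code_simp

lemma exists_24_points:
  "\<exists>X :: (real ^ 4) set. finite X \<and> X \<subseteq> sphere 0 1 \<and> pairwise (\<lambda>x y. x \<bullet> y \<le> 1/2) X \<and> card X = 24"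
proof (intro exI conjI)
  let ?X = "half_vector ` set hurwitz_doubled"
  have i: "inner4 p p = 4" if "p \<in> set hurwitz_doubled" for p
    using hurwitz_inner that unfolding list_all_iff by metis
  have j: "inner4 p q \<le> 2" if "p \<in> set hurwitz_doubled" "q \<in> set hurwitz_doubled" "p \<noteq> q" for p q
    using hurwitz_inner that unfolding list_all_iff by metis
  show "finite ?X" by simp
  show "?X \<subseteq> sphere 0 1" by (force simp: norm_eq_1 inner_half_vector i)
  show "pairwise (\<lambda>x y. x \<bullet> y \<le> 1/2) ?X"
    unfolding pairwise_def by (force simp: inner_half_vector dest: j)
  have "inj_on half_vector (set hurwitz_doubled)"
  proof (rule inj_onI, rule ccontr)
    fix p q assume pq: "p \<in> set hurwitz_doubled" "q \<in> set hurwitz_doubled"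
      "half_vector p = half_vector q" "p \<noteq> q"
    \<comment> \<open>Two entries with the same image would have \<open>inner4\<close> equal to 4,
      against the bound 2.\<close>
    then have "inner4 p q = inner4 p p"
      using inner_half_vector[of p q] inner_half_vector[of p p] by simp
    then show False using i[of p] j[of p q] pq by simp
  qed
  then show "card ?X = 24"
    using hurwitz_inner by (simp add: card_image distinct_card)
qed

theorem mainTheorem1:
  shows "kissing_number TYPE(4) = 24"
  unfolding kissing_number_def
proof (rule Max_eqI)
  show "finite {card C | (p :: real ^ 4) r C. kissing_configuration p r C}"
    by (rule finite_kissing_cards)
  show "24 \<in> {card C | (p :: real ^ 4) r C. kissing_configuration p r C}"
    unfolding kissing_cards_eq_spherical_codes using exists_24_points by force
next
  fix n assume "n \<in> {card C | (p :: real ^ 4) r C. kissing_configuration p r C}"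
  then obtain X :: "(real ^ 4) set" where X: "n = card X" "finite X" "X \<subseteq> sphere 0 1"
    "pairwise (\<lambda>x y. x \<bullet> y \<le> 1/2) X"
    unfolding kissing_cards_eq_spherical_codes by auto
  show "n \<le> 24"
  proof (rule ccontr)
    assume "\<not> n \<le> 24"
    \<comment> \<open>The certificate is tied to exactly 25 points, so a larger code is first cut
      down to a subset of that size.\<close>
    then obtain Y where "Y \<subseteq> X" "card Y = 25"
      using X(1) obtain_subset_with_card_n[of 25 X] by auto
    then show False
      using no_25_points[of Y] X finite_subset[of Y X] pairwise_subset[of _ X Y] by blast
  qed
qed

end
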